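(* Assume the weak approximation property holds with constant $\eta_w>0$: for every $\mathbf v\in\mathbb R^n$ there is $\mathbf v_c\in\mathbb R^{n_c}$ with $\|\mathbf v-P\mathbf v_c\|_D\le\eta_w\|\mathbf v\|_A$. Let $\nu\ge1$ and let $\widetilde\pi_f$ and $\widetilde P=(I-\widetilde\pi_f)P$ be defined with the smoothed-aggregation polynomial $p_\nu$. For $\mathbf f\in\mathbb R^n$ let $\mathbf u$ solve $A\mathbf u=\mathbf f$, let $\widetilde{\mathbf u}_c\in\mathbb R^{n_c}$ solve $\widetilde P^TA\widetilde P\,\widetilde{\mathbf u}_c=\widetilde P^T\mathbf f$, and let $\mathbf e=\mathbf u-(I-\pi_f)P\mathbf u_c$, where $\mathbf u_c\in\mathbb R^{n_c}$ solves $P^T(I-\pi_f)^TA(I-\pi_f)P\,\mathbf u_c=P^T(I-\pi_f)^T\mathbf f$. Then $$\|\mathbf u-\widetilde P\widetilde{\mathbf u}_c\|_A\le\|\mathbf e\|_A+\|(\widetilde\pi_f-\pi_f)\pi_D\mathbf u\|_A\le\eta_w\|D^{-\frac12}A\mathbf u\|+\frac{\eta_w^2}{2\nu+1}\|\mathbf u\|_A.$$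
   Context: $A\in\mathbb R^{n\times n}$ is symmetric positive definite (SPD), and $D\in\mathbb R^{n\times n}$ is a diagonal SPD matrix with $\mathbf v^TA\mathbf v\le\mathbf v^TD\mathbf v$ for all $\mathbf v\in\mathbb R^n$. For an SPD matrix $B$, $\|\mathbf v\|_B=\sqrt{\mathbf v^TB\mathbf v}$; $\|\cdot\|$ is the Euclidean norm. The index set $\{1,\dots,n\}$ is partitioned into nonoverlapping aggregates $\mathcal A_1,\dots,\mathcal A_{n_a}$. The prolongation $P\in\mathbb R^{n\times n_c}$, of full column rank with $1\le n_c<n$, is block diagonal with respect to this partition, with blocks $P_{\mathcal A_i}$ (rows indexed by $\mathcal A_i$). On each aggregate, let $D_{\mathcal A_i}=D|_{\mathcal A_i}$ and choose vectors that are orthonormal with respect to $D_{\mathcal A_i}$ and span the $D_{\mathcal A_i}$-orthogonal complement of $\operatorname{Range}(P_{\mathcal A_i})$. Extended by zero outside $\mathcal A_i$, these vectors (for all $i$) are the columns of $P_\perp\in\mathbb R^{n\times(n-n_c)}$. Thus $P_\perp^TDP=0$ and $P_\perp^TDP_\perp=I$. Define $\pi_D=P(P^TDP)^{-1}P^TD$, $A_f=P_\perp^TAP_\perp$ and $\pi_f=P_\perp A_f^{-1}P_\perp^TA$. The smoothed-aggregation (SA) polynomial of degree $\nu$ is $p_\nu(t)=\frac{(-1)^\nu}{2\nu+1}\frac{T_{2\nu+1}(\sqrt t)}{\sqrt t}$, where $T_k$ is the Chebyshev polynomial of the first kind of degree $k$; it satisfies $p_\nu(0)=1$. Write $p_\nu(t)=1-t\,q_{\nu-1}(t)$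 with $q_{\nu-1}$ a polynomial of degree $\nu-1$, and set $\widetilde A_f^{-1}:=q_{\nu-1}(A_f)$ and $\widetilde\pi_f:=P_\perp\widetilde A_f^{-1}P_\perp^TA$. *)

theory Defs
  imports "HOL-Analysis.Analysis" "HOL-Computational_Algebra.Polynomial"
begin

definition spd :: "real^'n^'n \<Rightarrow> bool" where
  "spd B \<longleftrightarrow> transpose B = B \<and> (\<forall>v. v \<noteq> 0 \<longrightarrow> 0 < v \<bullet> (B *v v))"

definition is_diagonal :: "real^'n^'n \<Rightarrow> bool" where
  "is_diagonal D \<longleftrightarrow> (\<forall>i j. i \<noteq> j \<longrightarrow> D $ i $ j = 0)"

definition energy_norm :: "real^'n^'n \<Rightarrow> real^'n \<Rightarrow> real" where
  "energy_norm B v = sqrt (v \<bullet> (B *v v))"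

definition diag_inv_sqrt :: "real^'n^'n \<Rightarrow> real^'n^'n" where
  "diag_inv_sqrt D = (\<chi> i j. if i = j then 1 / sqrt (D $ i $ i) else 0)"

lemma spd_diag_pos:
  assumes "spd D"
  shows "0 < D $ i $ i"
proof -
  have "axis i (1::real) \<noteq> 0" by (simp add: axis_eq_0_iff)
  then have "0 < axis i 1 \<bullet> (D *v axis i 1)"
    using assms unfolding spd_def by blast
  also have "\<dots> = D $ i $ i"
    unfolding matrix_vector_mul_component inner_axis' by (simp add: inner_axis)
  finally show ?thesis .
qed

lemma diagonal_mult:
  fixes M :: "real^'n^'n"
  assumes "is_diagonal B"
  shows "(B ** M) $ i $ j = B $ i $ i * M $ i $ j"
proof -
  have "(B ** M) $ i $ j = (\<Sum>k\<in>UNIV. B $ i $ k * M $ k $ j)"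
    by (simp add: matrix_matrix_mult_def)
  also have "\<dots> = (\<Sum>k\<in>{i}. B $ i $ k * M $ k $ j)"
    using assms by (intro sum.mono_neutral_right) (auto simp: is_diagonal_def)
  finally show ?thesis by simp
qed

lemma diag_inv_sqrt:
  fixes D :: "real^'n^'n"
  assumes "spd D" "is_diagonal D"
  shows "diag_inv_sqrt D ** (diag_inv_sqrt D ** D) = mat 1"
proof -
  have d: "is_diagonal (diag_inv_sqrt D)"
    by (simp add: is_diagonal_def diag_inv_sqrt_def)
  have "(diag_inv_sqrt D ** (diag_inv_sqrt D ** D)) $ i $ j = (mat 1 :: real^'n^'n) $ i $ j" for i j
  proof (cases "i = j")
    case True
    have "1 / sqrt (D $ j $ j) * (1 / sqrt (D $ j $ j) * D $ j $ j) = 1"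
      using spd_diag_pos[OF assms(1), of j] by (simp add: field_simps)
    then show ?thesis
      unfolding diagonal_mult[OF d] True by (simp add: diag_inv_sqrt_def mat_def)
  next
    case False
    then have "D $ i $ j = 0" using assms(2) unfolding is_diagonal_def by blast
    then show ?thesis
      unfolding diagonal_mult[OF d] using False by (simp add: mat_def)
  qed
  then show ?thesis by (simp add: vec_eq_iff)
qed


text \<open>
  The block of \<open>M\<close> with rows \<open>R\<close> and columns \<open>C\<close> is kept at the size of \<open>M\<close> and filled
  with zeros.  In the same way a vector on an aggregate \<open>S\<close> is a vector of full length
  vanishing outside \<open>S\<close>; this builds in the extension by zero.
\<close>

definition sub_block :: "real^'b^'a \<Rightarrow> 'a set \<Rightarrow> 'b set \<Rightarrow> real^'b^'a" where
  "sub_block M R C = (\<chi> i j. if i \<in> R \<and> j \<in> C then M $ i $ j else 0)"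

text \<open>
  \<open>blk j\<close> is the aggregate to which column \<open>j\<close> belongs, so the columns of the diagonal block
  of the aggregate \<open>S\<close> are those in \<open>{j. blk j = S}\<close>.  No ordering of the rows or columns is
  implied, and a block may have no columns.
\<close>

definition block_diagonal :: "'n set set \<Rightarrow> ('c \<Rightarrow> 'n set) \<Rightarrow> real^'c^'n \<Rightarrow> bool" where
  "block_diagonal Agg blk M \<longleftrightarrow>
     (\<forall>j. blk j \<in> Agg) \<and> (\<forall>i j. i \<notin> blk j \<longrightarrow> M $ i $ j = 0)"

definition diag_block :: "('c \<Rightarrow> 'n set) \<Rightarrow> real^'c^'n \<Rightarrow> 'n set \<Rightarrow> real^'c^'n" where
  "diag_block blk M S = sub_block M S {j. blk j = S}"

definition local_orth_complement ::
    "real^'n^'n \<Rightarrow> ('c \<Rightarrow> 'n set) \<Rightarrow> real^'c^'n \<Rightarrow> 'n set \<Rightarrow> (real^'n) set" where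
  "local_orth_complement D blk P S =
     {v. (\<forall>i. i \<notin> S \<longrightarrow> v $ i = 0) \<and>
         (\<forall>w \<in> range (\<lambda>x. diag_block blk P S *v x). v \<bullet> (sub_block D S S *v w) = 0)}"

definition is_perp_basis ::
    "'n set set \<Rightarrow> real^'n^'n \<Rightarrow> ('c \<Rightarrow> 'n set) \<Rightarrow> real^'c^'n
      \<Rightarrow> ('f \<Rightarrow> 'n set) \<Rightarrow> real^'f^'n \<Rightarrow> bool" where
  "is_perp_basis Agg D blk P fblk Pp \<longleftrightarrow>
     block_diagonal Agg fblk Pp \<and>
     (\<forall>S \<in> Agg.
        (\<forall>k l. fblk k = S \<longrightarrow> fblk l = S \<longrightarrow>
           column k Pp \<bullet> (sub_block D S S *v column l Pp) = (if k = l then 1 else 0)) \<and>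
        span {column k Pp | k. fblk k = S} = local_orth_complement D blk P S)"


fun cheb :: "nat \<Rightarrow> real poly" where
  "cheb 0 = 1"
| "cheb (Suc 0) = [:0, 1:]"
| "cheb (Suc (Suc k)) = [:0, 2:] * cheb (Suc k) - cheb k"

definition sa_poly :: "nat \<Rightarrow> real poly" where
  "sa_poly \<nu> = (THE p. \<forall>t>0. poly p t =
     (-1) ^ \<nu> / (2 * real \<nu> + 1) * (poly (cheb (2 * \<nu> + 1)) (sqrt t) / sqrt t))"

definition sa_q :: "nat \<Rightarrow> real poly" where
  "sa_q \<nu> = (THE q. sa_poly \<nu> = 1 - [:0, 1:] * q)"

lemma cheb_parity:
  "\<exists>R S. (\<forall>x. poly (cheb (2 * k)) x = poly S (x\<^sup>2)) \<and>
         (\<forall>x. poly (cheb (2 * k + 1)) x = x * poly R (x\<^sup>2)) \<and>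
         poly S 0 = (-1) ^ k \<and> poly R 0 = (-1) ^ k * (2 * real k + 1)"
proof (induction k)
  case 0
  show ?case
    by (rule exI[of _ 1], rule exI[of _ 1]) simp
next
  case (Suc k)
  then obtain R S where
    S: "\<And>x. poly (cheb (2 * k)) x = poly S (x\<^sup>2)" "poly S 0 = (-1) ^ k" and
    R: "\<And>x. poly (cheb (2 * k + 1)) x = x * poly R (x\<^sup>2)"
       "poly R 0 = (-1) ^ k * (2 * real k + 1)"
    by auto
  define S' where "S' = [:0, 2:] * R - S"
  define R' where "R' = [:2:] * S' - R"
  have S': "poly (cheb (2 * Suc k)) x = poly S' (x\<^sup>2)" for x
    using S(1)[of x] R(1)[of x] by (simp add: S'_def power2_eq_square)
  have R': "poly (cheb (2 * Suc k + 1)) x = x * poly R' (x\<^sup>2)" for x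
  proof -
    have "poly (cheb (2 * Suc k + 1)) x = 2 * x * poly (cheb (2 * Suc k)) x - poly (cheb (2 * k + 1)) x"
      by simp
    also have "\<dots> = x * poly R' (x\<^sup>2)"
      unfolding S' R(1) by (simp add: R'_def algebra_simps)
    finally show ?thesis .
  qed
  have "poly S' 0 = (-1) ^ Suc k" "poly R' 0 = (-1) ^ Suc k * (2 * real (Suc k) + 1)"
    using S(2) R(2) by (simp_all add: S'_def R'_def algebra_simps)
  with S' R' show ?case by blast
qed

lemma poly_eq_on_pos:
  fixes p q :: "real poly"
  assumes "\<And>t. 0 < t \<Longrightarrow> poly p t = poly q t"
  shows "p = q"
proof (rule ccontr)
  assume "p \<noteq> q"
  then have "finite {t. poly (p - q) t = 0}" by (intro poly_roots_finite) simp
  moreover have "{0<..} \<subseteq> {t. poly (p - q) t = 0}" using assms by auto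
  ultimately show False using finite_subset infinite_Ioi by blast
qed

lemma sa_poly:
  shows "0 < t \<Longrightarrow> poly (sa_poly \<nu>) t =
           (-1) ^ \<nu> / (2 * real \<nu> + 1) * (poly (cheb (2 * \<nu> + 1)) (sqrt t) / sqrt t)"
    and "poly (sa_poly \<nu>) 0 = 1"
proof -
  let ?F = "\<lambda>t. (-1) ^ \<nu> / (2 * real \<nu> + 1) * (poly (cheb (2 * \<nu> + 1)) (sqrt t) / sqrt t)"
  obtain R where R: "\<And>x. poly (cheb (2 * \<nu> + 1)) x = x * poly R (x\<^sup>2)"
      "poly R 0 = (-1) ^ \<nu> * (2 * real \<nu> + 1)"
    using cheb_parity[of \<nu>] by blast
  define p where "p = smult ((-1) ^ \<nu> / (2 * real \<nu> + 1)) R"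
  have p: "\<forall>t>0. poly p t = ?F t"
    unfolding R(1) by (simp add: p_def)
  have eq: "sa_poly \<nu> = p"
    unfolding sa_poly_def
  proof (rule the_equality)
    show "\<forall>t>0. poly p t = ?F t" by (rule p)
    show "p' = p" if "\<forall>t>0. poly p' t = ?F t" for p'
      using that p by (intro poly_eq_on_pos) simp
  qed
  show "0 < t \<Longrightarrow> poly (sa_poly \<nu>) t = ?F t" using p eq by blast
  have "(-1) ^ \<nu> * (-1) ^ \<nu> = (1 :: real)" by (simp flip: power_mult_distrib)
  moreover have "2 * real \<nu> + 1 \<noteq> 0" by linarith
  ultimately show "poly (sa_poly \<nu>) 0 = 1" unfolding eq p_def by (simp add: R(2))
qed

lemma sa_q: "sa_poly \<nu> = 1 - [:0, 1:] * sa_q \<nu>"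
  unfolding sa_q_def
proof (rule theI')
  have "poly (1 - sa_poly \<nu>) 0 = 0" by (simp add: sa_poly(2))
  then obtain q where q: "1 - sa_poly \<nu> = [:0, 1:] * q"
    by (metis add.inverse_neutral poly_eq_0_iff_dvd dvdE)
  have "sa_poly \<nu> = 1 - [:0, 1:] * q"
    unfolding q[symmetric] by simp
  moreover have "q' = q" if "sa_poly \<nu> = 1 - [:0, 1:] * q'" for q'
  proof -
    have "[:0, 1:] * q' = [:0, 1:] * q" using that q by simp
    then show ?thesis by (metis mult_cancel_left pCons_eq_0_iff zero_neq_one)
  qed
  ultimately show "\<exists>!q. sa_poly \<nu> = 1 - [:0, 1:] * q" by blast
qed


primrec mat_power :: "real^'n^'n \<Rightarrow> nat \<Rightarrow> real^'n^'n" where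
  "mat_power B 0 = mat 1"
| "mat_power B (Suc k) = B ** mat_power B k"

definition mat_poly :: "real poly \<Rightarrow> real^'n^'n \<Rightarrow> real^'n^'n" where
  "mat_poly p B = (\<Sum>k\<le>degree p. coeff p k *\<^sub>R mat_power B k)"

definition pi_D :: "real^'n^'n \<Rightarrow> real^'c^'n \<Rightarrow> real^'n^'n" where
  "pi_D D P = P ** matrix_inv (transpose P ** D ** P) ** transpose P ** D"

definition fine_matrix :: "real^'n^'n \<Rightarrow> real^'f^'n \<Rightarrow> real^'f^'f" where
  "fine_matrix A Pp = transpose Pp ** A ** Pp"

definition pi_f :: "real^'n^'n \<Rightarrow> real^'f^'n \<Rightarrow> real^'n^'n" where
  "pi_f A Pp = Pp ** matrix_inv (fine_matrix A Pp) ** transpose Pp ** A"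

definition approx_pi_f :: "nat \<Rightarrow> real^'n^'n \<Rightarrow> real^'f^'n \<Rightarrow> real^'n^'n" where
  "approx_pi_f \<nu> A Pp = Pp ** mat_poly (sa_q \<nu>) (fine_matrix A Pp) ** transpose Pp ** A"

definition weak_approximation ::
    "real^'n^'n \<Rightarrow> real^'n^'n \<Rightarrow> real^'c^'n \<Rightarrow> real \<Rightarrow> bool" where
  "weak_approximation A D P \<eta> \<longleftrightarrow>
     (\<forall>v. \<exists>vc. energy_norm D (v - P *v vc) \<le> \<eta> * energy_norm A v)"

end

theory Submission
  imports Defs
begin

text \<open>
  Write \<open>\<pi>\<close> for \<open>pi_f A Pp\<close>, \<open>\<pi>t\<close> for its polynomial approximation, and \<open>w = pi_D D P *v u\<close>.
  The ranges of \<open>P\<close> and \<open>Pp\<close> are \<open>D\<close>-orthogonal complements of each other, so \<open>pi_D D P\<close> is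
  the \<open>D\<close>-orthogonal projection onto the coarse range, and \<open>\<pi>\<close> is the \<open>A\<close>-orthogonal projection
  onto the fine range.  Consequently the coarse space of the ideal method, the range of
  \<open>(I - \<pi>)P\<close>, is the \<open>A\<close>-orthogonal complement of the fine range, and its error is \<open>e = \<pi>u\<close>
  (lemma \<open>ideal_error_eq\<close>).

  For the first inequality, a Galerkin solution is the best approximation in its space, so it
  may be replaced by the competitor \<open>(I - \<pi>t)w\<close>.  As \<open>u - w\<close> lies in the fine range, it is
  fixed by \<open>\<pi>\<close>; hence \<open>u - (I - \<pi>)w = \<pi>u = e\<close>, the error of the competitor is
  \<open>e + (\<pi>t - \<pi>)w\<close>, and the triangle inequality applies.

  For the second inequality, the weak approximation property says that on the fine range the
  \<open>D\<close>-norm is at most \<open>\<eta>\<close> times the \<open>A\<close>-norm, since the nearest coarse vector in the \<open>D\<close>-norm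
  is \<open>0\<close>.  With \<open>\<parallel>e\<parallel>\<^sub>A\<^sup>2 = e \<bullet> Au\<close> and the Cauchy-Schwarz inequality this bounds the first term
  (lemma \<open>pi_f_le\<close>).  For the other term put \<open>\<pi>w = Pp h\<close>.  Then \<open>(\<pi>t - \<pi>)w = - Pp p(A\<^sub>f)h\<close>
  with the smoothed-aggregation polynomial \<open>p\<close>, and \<open>A \<le> D\<close> gives \<open>A\<^sub>f \<le> I\<close>.  On \<open>(0,1]\<close> one
  has \<open>t p(t)\<^sup>2 \<le> 1 / (2\<nu>+1)\<^sup>2\<close>, because \<open>(2\<nu>+1)\<^sup>2 t p(t)\<^sup>2\<close> is the square of a Chebyshev polynomial
  at \<open>\<surd>t\<close>.  The Pell equation turns this inequality into the polynomial identity
  \<open>1 = (2\<nu>+1)\<^sup>2 t p(t)\<^sup>2 + (1-t) r(t)\<^sup>2\<close>, which can be evaluated at the matrix \<open>A\<^sub>f\<close> directly, so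
  that no diagonalization is involved (lemma \<open>sa_poly_smoothing\<close>).  The result is
  \<open>\<parallel>(\<pi>t - \<pi>)w\<parallel>\<^sub>A \<le> \<parallel>\<pi>w\<parallel>\<^sub>D / (2\<nu>+1)\<close>.  Finally \<open>\<pi>w\<close> equals \<open>-(I - pi_D)(I - \<pi>)u\<close>, which the
  weak approximation property bounds by \<open>\<eta>\<^sup>2 \<parallel>u\<parallel>\<^sub>A\<close> in the \<open>D\<close>-norm (lemma \<open>pi_f_pi_D_le\<close>).
\<close>

section \<open>Energy inner products\<close>

lemma inner_matrix_vector_transpose:
  fixes M :: "real^'m^'n"
  shows "x \<bullet> (M *v y) = (transpose M *v x) \<bullet> y"
  by (simp add: dot_lmul_matrix)

\<comment> \<open>Adjoints are to stay visible as transposes instead of turning into row-vector products.\<close>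
declare transpose_matrix_vector [simp del]

lemma inner_congruence:
  fixes M :: "real^'n^'n" and Q :: "real^'m^'n"
  shows "(Q *v x) \<bullet> (M *v (Q *v y)) = x \<bullet> ((transpose Q ** M ** Q) *v y)"
  by (simp add: inner_matrix_vector_transpose[of x "transpose Q"]
      flip: matrix_vector_mul_assoc)

lemma spd_inner_commute:
  assumes "spd B"
  shows "x \<bullet> (B *v y) = y \<bullet> (B *v x)"
  using assms inner_matrix_vector_transpose[of x B y] by (simp add: spd_def inner_commute)

lemma spd_inner_ge_0:
  assumes "spd B"
  shows "0 \<le> v \<bullet> (B *v v)"
  using assms by (cases "v = 0") (auto simp: spd_def less_imp_le)

lemma spd_inner_eq_0_iff:
  assumes "spd B"
  shows "v \<bullet> (B *v v) = 0 \<longleftrightarrow> v = 0"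
  using assms by (cases "v = 0") (auto simp: spd_def less_le)

lemma spd_congruence:
  fixes B :: "real^'n^'n" and Q :: "real^'m^'n"
  assumes B: "spd B" and inj: "\<And>x. Q *v x = 0 \<Longrightarrow> x = 0"
  shows "spd (transpose Q ** B ** Q)"
  unfolding spd_def
proof (intro conjI allI impI)
  show "transpose (transpose Q ** B ** Q) = transpose Q ** B ** Q"
    using B by (simp add: spd_def matrix_transpose_mul matrix_mul_assoc)
  fix v :: "real^'m" assume "v \<noteq> 0"
  then have "Q *v v \<noteq> 0" using inj by blast
  then show "0 < v \<bullet> ((transpose Q ** B ** Q) *v v)"
    using B by (simp add: spd_def flip: inner_congruence)
qed

lemma spd_matrix_inv:
  fixes B :: "real^'n^'n"
  assumes "spd B"
  shows "matrix_inv B ** B = mat 1" and "B ** matrix_inv B = mat 1"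
proof -
  have "x = 0" if "B *v x = 0" for x
    using spd_inner_eq_0_iff[OF assms, of x] that by simp
  then have "invertible B"
    by (simp add: invertible_left_inverse matrix_left_invertible_ker)
  then have "B ** matrix_inv B = mat 1 \<and> matrix_inv B ** B = mat 1"
    unfolding invertible_def matrix_inv_def by (rule someI_ex)
  then show "matrix_inv B ** B = mat 1" "B ** matrix_inv B = mat 1"
    by simp_all
qed

lemma energy_norm_ge_0:
  assumes "spd B"
  shows "0 \<le> energy_norm B v"
  using spd_inner_ge_0[OF assms] by (simp add: energy_norm_def)

lemma energy_norm_power2:
  assumes "spd B"
  shows "(energy_norm B v)\<^sup>2 = v \<bullet> (B *v v)"
  using spd_inner_ge_0[OF assms] by (simp add: energy_norm_def)

lemma energy_norm_minus_commute: "energy_norm B (x - y) = energy_norm B (y - x)"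
  by (simp add: energy_norm_def matrix_vector_mult_diff_distrib inner_diff_left inner_diff_right)

lemma energy_pythagoras:
  assumes "spd B" and "x \<bullet> (B *v y) = 0"
  shows "(energy_norm B (x + y))\<^sup>2 = (energy_norm B x)\<^sup>2 + (energy_norm B y)\<^sup>2"
  using assms spd_inner_commute[OF assms(1), of x y]
  by (simp add: energy_norm_power2 matrix_vector_right_distrib inner_add_left inner_add_right)

lemma energy_norm_le_orthogonal_add:
  assumes "spd B" and "x \<bullet> (B *v y) = 0"
  shows "energy_norm B x \<le> energy_norm B (x + y)"
  using energy_pythagoras[OF assms] energy_norm_ge_0[OF assms(1)]
  by (intro power2_le_imp_le[of "energy_norm B x"]) auto

lemma energy_Cauchy_Schwarz:
  assumes B: "spd B"
  shows "x \<bullet> (B *v y) \<le> energy_norm B x * energy_norm B y"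
proof (cases "y = 0")
  case False
  define a b c where "a = x \<bullet> (B *v x)" and "b = x \<bullet> (B *v y)" and "c = y \<bullet> (B *v y)"
  have c: "0 < c" using B False by (simp add: spd_def c_def)
  have b': "y \<bullet> (B *v x) = b" by (simp add: b_def spd_inner_commute[OF B, of y x])
  \<comment> \<open>The vector \<open>?z\<close> is \<open>c\<close> times the component of \<open>x\<close> that is \<open>B\<close>-orthogonal to \<open>y\<close>.\<close>
  let ?z = "c *\<^sub>R x - b *\<^sub>R y"
  have "?z \<bullet> (B *v ?z) = c * (c * a - b * b) "
    using b' by (simp add: matrix_vector_mult_diff_distrib matrix_vector_mult_scaleR
        inner_diff_left inner_diff_right algebra_simps flip: a_def b_def c_def)
  then have "0 \<le> c * (a * c - b\<^sup>2)"
    using spd_inner_ge_0[OF B, of ?z] by (simp add: algebra_simps power2_eq_square)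
  then have "b\<^sup>2 \<le> (energy_norm B x * energy_norm B y)\<^sup>2"
    using c by (simp add: power_mult_distrib energy_norm_power2[OF B] zero_le_mult_iff
        flip: a_def c_def)
  then show ?thesis
    unfolding b_def by (rule power2_le_imp_le) (simp add: energy_norm_ge_0[OF B])
qed (simp add: energy_norm_def)

lemma energy_norm_triangle:
  assumes B: "spd B"
  shows "energy_norm B (x + y) \<le> energy_norm B x + energy_norm B y"
proof (rule power2_le_imp_le)
  have "(energy_norm B (x + y))\<^sup>2
      = (energy_norm B x)\<^sup>2 + 2 * (x \<bullet> (B *v y)) + (energy_norm B y)\<^sup>2"
    using spd_inner_commute[OF B, of y x]
    by (simp add: energy_norm_power2[OF B] matrix_vector_right_distrib inner_add_left inner_add_right)
  then show "(energy_norm B (x + y))\<^sup>2 \<le> (energy_norm B x + energy_norm B y)\<^sup>2"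
    using energy_Cauchy_Schwarz[OF B, of x y] by (simp add: power2_sum)
  show "0 \<le> energy_norm B x + energy_norm B y"
    using energy_norm_ge_0[OF B] by simp
qed

text \<open>
  The Galerkin system says that the residual is \<open>A\<close>-orthogonal to the range of \<open>Q\<close>;
  optimality is then the Pythagorean theorem.
\<close>

lemma galerkin_best_approximation:
  fixes A :: "real^'n^'n" and Q :: "real^'m^'n"
  assumes A: "spd A" and galerkin: "(transpose Q ** A ** Q) *v x = transpose Q *v (A *v u)"
  shows "(Q *v z) \<bullet> (A *v (u - Q *v x)) = 0"
    and "energy_norm A (u - Q *v x) \<le> energy_norm A (u - Q *v z)"
proof -
  have "transpose Q *v (A *v (u - Q *v x)) = 0"
    using galerkin by (simp add: matrix_vector_mult_diff_distrib matrix_vector_mul_assoc matrix_mul_assoc)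
  then show orth: "(Q *v z) \<bullet> (A *v (u - Q *v x)) = 0" for z
    by (metis inner_matrix_vector_transpose inner_commute inner_zero_left)
  have "(u - Q *v x) \<bullet> (A *v (Q *v (x - z))) = 0"
    using orth[of "x - z"] by (simp add: spd_inner_commute[OF A])
  then have "energy_norm A (u - Q *v x) \<le> energy_norm A ((u - Q *v x) + Q *v (x - z))"
    by (rule energy_norm_le_orthogonal_add[OF A])
  then show "energy_norm A (u - Q *v x) \<le> energy_norm A (u - Q *v z)"
    by (simp add: matrix_vector_mult_diff_distrib)
qed

text \<open>
  The dual of the \<open>D\<close>-norm under the Euclidean inner product: with \<open>G\<close> the inverse square root of
  \<open>D\<close>, write \<open>v = G(GDv)\<close>, move one \<open>G\<close> to the other side and use that \<open>GDv\<close> has the Euclidean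
  norm \<open>\<parallel>v\<parallel>\<^sub>D\<close>.
\<close>

lemma diag_inv_sqrt_Cauchy_Schwarz:
  fixes D :: "real^'n^'n"
  assumes D: "spd D" "is_diagonal D"
  shows "v \<bullet> w \<le> energy_norm D v * norm (diag_inv_sqrt D *v w)"
proof -
  let ?G = "diag_inv_sqrt D"
  have sym: "transpose ?G = ?G"
    by (auto simp: diag_inv_sqrt_def transpose_def vec_eq_iff)
  have inv: "?G *v (?G *v (D *v v)) = v"
    using diag_inv_sqrt[OF D] by (simp add: matrix_vector_mul_assoc)
  have "norm (?G *v (D *v v)) = energy_norm D v"
    using inner_matrix_vector_transpose[of "?G *v (D *v v)" ?G "D *v v"] sym inv
    by (simp add: norm_eq_sqrt_inner energy_norm_def)
  moreover have "v \<bullet> w = (?G *v (D *v v)) \<bullet> (?G *v w)"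
    using inner_matrix_vector_transpose[of "?G *v (D *v v)" ?G w] sym inv by simp
  ultimately show ?thesis using norm_cauchy_schwarz[of "?G *v (D *v v)" "?G *v w"] by simp
qed

section \<open>Polynomials of a matrix\<close>

lemma matrix_mult_scaleR:
  fixes M N :: "real^'n^'n"
  shows "M ** (c *\<^sub>R N) = c *\<^sub>R (M ** N)" "(c *\<^sub>R M) ** N = c *\<^sub>R (M ** N)"
  by (simp_all add: vec_eq_iff matrix_matrix_mult_def sum_distrib_left mult_ac)

lemma matrix_mult_add_left:
  fixes L M N :: "real^'n^'n"
  shows "(L + M) ** N = L ** N + M ** N"
  by (simp add: vec_eq_iff matrix_matrix_mult_def distrib_right sum.distrib)

lemma matrix_mult_sum_right:
  fixes M :: "real^'n^'n" and N :: "'i \<Rightarrow> real^'n^'n"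
  shows "M ** sum N S = (\<Sum>i\<in>S. M ** N i)"
  by (induction S rule: infinite_finite_induct) (simp_all add: matrix_add_ldistrib)

lemma mat_poly_0 [simp]: "mat_poly 0 M = 0"
  by (simp add: mat_poly_def)

lemma mat_poly_eq_sum:
  assumes "degree p \<le> n"
  shows "mat_poly p M = (\<Sum>k\<le>n. coeff p k *\<^sub>R mat_power M k)"
  unfolding mat_poly_def using assms
  by (intro sum.mono_neutral_left) (auto simp: coeff_eq_0)

lemma mat_poly_add: "mat_poly (p + q) M = mat_poly p M + mat_poly q M"
proof -
  let ?n = "max (degree p) (degree q)"
  have "degree (p + q) \<le> ?n" by (rule degree_add_le_max)
  then show ?thesis
    by (simp add: mat_poly_eq_sum[of _ ?n] scaleR_add_left sum.distrib)
qed

lemma mat_poly_smult: "mat_poly (smult c p) M = c *\<^sub>R mat_poly p M"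
  by (simp add: mat_poly_eq_sum[of "smult c p" "degree p"] degree_smult_le
      mat_poly_def scaleR_sum_right)

text \<open>
  The Horner step.  It gives evaluation at a matrix the same recursion as the induction rule for
  polynomials, which is how multiplicativity and symmetry are obtained below.
\<close>

lemma mat_poly_pCons: "mat_poly (pCons a p) M = a *\<^sub>R mat 1 + M ** mat_poly p M"
proof -
  have "mat_poly (pCons a p) M
      = (\<Sum>k\<le>Suc (degree p). coeff (pCons a p) k *\<^sub>R mat_power M k)"
    by (rule mat_poly_eq_sum) (rule degree_pCons_le)
  also have "\<dots> = a *\<^sub>R mat 1 + M ** mat_poly p M"
    unfolding sum.atMost_Suc_shift
    by (simp add: mat_poly_def matrix_mult_scaleR matrix_mult_sum_right)
  finally show ?thesis .
qed

lemma mat_poly_1 [simp]: "mat_poly 1 M = mat 1"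
  by (simp add: one_pCons mat_poly_pCons)

lemma mat_poly_mult: "mat_poly (p * q) M = mat_poly p M ** mat_poly q M"
  by (induction p)
    (simp_all add: mat_poly_pCons mat_poly_add mat_poly_smult matrix_mult_scaleR
      matrix_mult_add_left matrix_mul_assoc)

lemma mat_poly_X: "mat_poly [:0, 1:] M = M"
  by (simp add: mat_poly_pCons)

lemma mat_poly_commute: "mat_poly p M ** M = M ** mat_poly p M"
  using mat_poly_mult[of p "[:0, 1:]" M] mat_poly_mult[of "[:0, 1:]" p M]
  by (simp add: mat_poly_X mult.commute del: mult_pCons_left mult_pCons_right)

lemma transpose_mat_poly:
  fixes M :: "real^'n^'n"
  assumes "transpose M = M"
  shows "transpose (mat_poly p M) = mat_poly p M"
proof (induction p)
  case (pCons a p)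
  have "transpose (X + Y) = transpose X + transpose Y" for X Y :: "real^'n^'n"
    by (simp add: transpose_def vec_eq_iff)
  moreover have "transpose (a *\<^sub>R mat 1 :: real^'n^'n) = a *\<^sub>R mat 1"
    by (simp add: transpose_def vec_eq_iff mat_def)
  ultimately show ?case
    using pCons assms by (simp add: mat_poly_pCons matrix_transpose_mul mat_poly_commute)
qed (simp add: transpose_def vec_eq_iff)

section \<open>The Chebyshev smoothing bound\<close>

text \<open>
  Here \<open>R\<close> and \<open>V\<close> are \<open>T\<^bsub>2k+1\<^esub>(x)/x\<close> and \<open>U\<^bsub>2k\<^esub>(x)\<close> as polynomials in \<open>t = x\<^sup>2\<close>, where \<open>U\<close> are the
  Chebyshev polynomials of the second kind.  For \<open>x = cos \<theta>\<close> the second clause is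
  \<open>cos(2k\<theta>) = cos \<theta> cos((2k+1)\<theta>) + sin \<theta> sin((2k+1)\<theta>)\<close> and the third, the Pell equation, is
  \<open>cos\<^sup>2 + sin\<^sup>2 = 1\<close> at the angle \<open>(2k+1)\<theta>\<close>.  The second clause makes the induction go through:
  it supplies the second sequence that the rotation by \<open>2\<theta>\<close> needs.
\<close>

lemma cheb_odd_Pell:
  "\<exists>R V. (\<forall>x. poly (cheb (2 * k + 1)) x = x * poly R (x\<^sup>2)) \<and>
         (\<forall>x. poly (cheb (2 * k)) x = x\<^sup>2 * poly R (x\<^sup>2) + (1 - x\<^sup>2) * poly V (x\<^sup>2)) \<and>
         (\<forall>t. t * (poly R t)\<^sup>2 + (1 - t) * (poly V t)\<^sup>2 = 1)"
proof (induction k)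
  case 0
  show ?case
    by (rule exI[of _ 1], rule exI[of _ 1]) simp
next
  case (Suc k)
  then obtain R V where
    R: "\<And>x. poly (cheb (2 * k + 1)) x = x * poly R (x\<^sup>2)" and
    V: "\<And>x. poly (cheb (2 * k)) x = x\<^sup>2 * poly R (x\<^sup>2) + (1 - x\<^sup>2) * poly V (x\<^sup>2)" and
    Pell: "\<And>t. t * (poly R t)\<^sup>2 + (1 - t) * (poly V t)\<^sup>2 = 1"
    by blast
  \<comment> \<open>Rotation by \<open>2\<theta>\<close>: \<open>2t-1\<close> is \<open>cos 2\<theta>\<close>, and \<open>2(1-t)\<close>, \<open>2t\<close> are \<open>sin 2\<theta>\<close> times \<open>tan \<theta>\<close>, \<open>cot \<theta>\<close>.\<close>
  define R' where "R' = [:-1, 2:] * R - [:2, -2:] * V"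
  define V' where "V' = [:0, 2:] * R + [:-1, 2:] * V"
  have R': "poly R' t = (2 * t - 1) * poly R t - 2 * (1 - t) * poly V t" for t
    by (simp add: R'_def algebra_simps)
  have V': "poly V' t = 2 * t * poly R t + (2 * t - 1) * poly V t" for t
    by (simp add: V'_def algebra_simps)
  have even: "poly (cheb (2 * Suc k)) x = x\<^sup>2 * poly R (x\<^sup>2) - (1 - x\<^sup>2) * poly V (x\<^sup>2)" for x
    using R[of x] V[of x] by (simp add: power2_eq_square algebra_simps)
  have "poly (cheb (2 * Suc k + 1)) x = 2 * x * poly (cheb (2 * Suc k)) x - poly (cheb (2 * k + 1)) x" for x
    by simp
  then have "poly (cheb (2 * Suc k + 1)) x = x * poly R' (x\<^sup>2)" for x
    unfolding even R R' by (simp add: algebra_simps)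
  moreover have "poly (cheb (2 * Suc k)) x = x\<^sup>2 * poly R' (x\<^sup>2) + (1 - x\<^sup>2) * poly V' (x\<^sup>2)" for x
    unfolding even R' V' by (simp only: power2_eq_square) algebra
  moreover have "t * (poly R' t)\<^sup>2 + (1 - t) * (poly V' t)\<^sup>2 = 1" for t
    using Pell[of t] unfolding R' V' by algebra
  ultimately show ?case by blast
qed

lemma sa_poly_Pell:
  "\<exists>r. 1 = smult ((2 * real \<nu> + 1)\<^sup>2) (sa_poly \<nu> * ([:0, 1:] * sa_poly \<nu>)) + r * ([:1, -1:] * r)"
proof -
  obtain R V where
    R: "\<And>x. poly (cheb (2 * \<nu> + 1)) x = x * poly R (x\<^sup>2)" and
    Pell: "\<And>t. t * (poly R t)\<^sup>2 + (1 - t) * (poly V t)\<^sup>2 = 1"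
    using cheb_odd_Pell[of \<nu>] by blast
  have "1 = smult ((2 * real \<nu> + 1)\<^sup>2) (sa_poly \<nu> * ([:0, 1:] * sa_poly \<nu>)) + V * ([:1, -1:] * V)"
  proof (rule poly_eq_on_pos)
    fix t :: real assume t: "0 < t"
    have "(2 * real \<nu> + 1) * poly (sa_poly \<nu>) t = (-1) ^ \<nu> * poly R t"
      using t unfolding sa_poly(1)[OF t] R by (simp add: field_simps)
    then have "((2 * real \<nu> + 1) * poly (sa_poly \<nu>) t)\<^sup>2 = ((-1) ^ \<nu> * poly R t)\<^sup>2"
      by simp
    then have "((2 * real \<nu> + 1) * poly (sa_poly \<nu>) t)\<^sup>2 = (poly R t)\<^sup>2"
      by (simp add: power_mult_distrib flip: power_mult)
    then show "poly 1 t = poly (smult ((2 * real \<nu> + 1)\<^sup>2) (sa_poly \<nu> * ([:0, 1:] * sa_poly \<nu>))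
        + V * ([:1, -1:] * V)) t"
      using Pell[of t] by (simp add: power_mult_distrib power2_eq_square algebra_simps)
  qed
  then show ?thesis by blast
qed

text \<open>
  This is the bound \<open>t p(t)\<^sup>2 \<le> 1 / (2\<nu>+1)\<^sup>2\<close> on \<open>[0,1]\<close> lifted to a matrix \<open>M \<le> I\<close>.  Evaluating the
  Pell identity at \<open>M\<close> and pairing it with \<open>h\<close> writes \<open>h \<bullet> h\<close> as the left-hand side plus
  \<open>z \<bullet> (I - M)z\<close> with \<open>z = r(M)h\<close>, and the latter is nonnegative.
\<close>

lemma sa_poly_smoothing:
  fixes M :: "real^'n^'n" and h :: "real^'n" and \<nu> :: nat
  assumes sym: "transpose M = M" and le: "\<And>v. v \<bullet> (M *v v) \<le> v \<bullet> v"
  defines "y \<equiv> mat_poly (sa_poly \<nu>) M *v h"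
  shows "(2 * real \<nu> + 1)\<^sup>2 * (y \<bullet> (M *v y)) \<le> h \<bullet> h"
proof -
  obtain r where r: "1 = smult ((2 * real \<nu> + 1)\<^sup>2) (sa_poly \<nu> * ([:0, 1:] * sa_poly \<nu>))
      + r * ([:1, -1:] * r)"
    using sa_poly_Pell by blast
  define z where "z = mat_poly r M *v h"
  \<comment> \<open>The factors in the Pell identity are arranged as \<open>p * (q * p)\<close> so that one symmetric outer
      factor can be moved to the left of the inner product.\<close>
  have quad: "h \<bullet> (mat_poly (p * (q * p)) M *v h)
      = (mat_poly p M *v h) \<bullet> (mat_poly q M *v (mat_poly p M *v h))" for p q
    by (simp add: mat_poly_mult transpose_mat_poly[OF sym]
        inner_matrix_vector_transpose[of h "mat_poly p M"] flip: matrix_vector_mul_assoc)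
  have lin: "mat_poly [:1, -1:] M = mat 1 - M"
  proof -
    have "[:1, -1:] = 1 + smult (-1) [:0, 1 :: real:]" by (simp add: one_pCons)
    then have "mat_poly [:1, -1:] M = mat 1 + (-1) *\<^sub>R M"
      by (simp only: mat_poly_add mat_poly_smult mat_poly_1 mat_poly_X)
    then show ?thesis by simp
  qed
  have "h \<bullet> h = h \<bullet> (mat_poly 1 M *v h)" by simp
  also have "\<dots> = (2 * real \<nu> + 1)\<^sup>2 * (y \<bullet> (M *v y)) + z \<bullet> ((mat 1 - M) *v z)"
    unfolding r mat_poly_add mat_poly_smult matrix_vector_mult_add_rdistrib inner_add_right
      scaleR_matrix_vector_assoc[symmetric] inner_scaleR_right quad
    by (simp only: mat_poly_X lin y_def z_def)
  also have "z \<bullet> ((mat 1 - M) *v z) = z \<bullet> z - z \<bullet> (M *v z)"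
    by (simp add: matrix_vector_mult_diff_rdistrib inner_diff_right)
  finally show ?thesis using le[of z] by simp
qed

section \<open>The block-diagonal basis is globally orthonormal\<close>

lemma transpose_mult_component:
  fixes D :: "real^'n^'n" and M :: "real^'a^'n" and N :: "real^'b^'n"
  shows "(transpose M ** D ** N) $ k $ j = column k M \<bullet> (D *v column j N)"
proof -
  have "(transpose M ** D ** N) $ k $ j = (transpose M ** (D ** N)) $ k $ j"
    by (simp add: matrix_mul_assoc)
  also have "\<dots> = column k M \<bullet> (D *v column j N)"
    by (simp add: matrix_matrix_mult_def transpose_def column_def inner_vec_def matrix_vector_mult_def)
  finally show ?thesis .
qed

lemma inner_sub_block:
  assumes "\<And>i. i \<notin> S \<Longrightarrow> v $ i = 0" and "\<And>i. i \<notin> S \<Longrightarrow> w $ i = 0"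
  shows "v \<bullet> (sub_block D S S *v w) = v \<bullet> (D *v w)"
proof -
  have "v $ i * (sub_block D S S $ i $ j * w $ j) = v $ i * (D $ i $ j * w $ j)" for i j
    using assms by (auto simp: sub_block_def)
  then show ?thesis
    by (simp only: inner_vec_def matrix_vector_mult_def vec_lambda_beta inner_real_def
        sum_distrib_left)
qed

lemma inner_diagonal_disjoint:
  assumes D: "is_diagonal D" and disj: "\<And>i. v $ i = 0 \<or> w $ i = 0"
  shows "v \<bullet> (D *v w) = 0"
proof -
  have "v $ i * (D $ i $ j * w $ j) = 0" for i j
    using D disj[of i] by (cases "i = j") (auto simp: is_diagonal_def)
  then show ?thesis
    by (simp only: inner_vec_def matrix_vector_mult_def vec_lambda_beta inner_real_def
        sum_distrib_left sum.neutral_const)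
qed

lemma column_eq_diag_block:
  assumes "block_diagonal Agg blk M"
  shows "column j M = diag_block blk M (blk j) *v axis j 1"
  using assms
  by (auto simp: vec_eq_iff column_def diag_block_def sub_block_def block_diagonal_def
      matrix_vector_mul_component inner_axis)

text \<open>
  Within one aggregate both identities are the defining properties of the local basis, because
  the zero-extended columns do not see the difference between \<open>D\<close> and its block.  Across different
  aggregates the supports are disjoint, and the diagonal \<open>D\<close> does not couple them.
\<close>

lemma perp_basis_orthonormal:
  fixes D :: "real^'n^'n" and P :: "real^'c^'n" and Pp :: "real^'f^'n"
  assumes D: "is_diagonal D" and part: "partition_on UNIV Agg"
    and P: "block_diagonal Agg blk P" and perp: "is_perp_basis Agg D blk P fblk Pp"
  shows "transpose Pp ** D ** P = 0" and "transpose Pp ** D ** Pp = mat 1"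
proof -
  have Pp: "block_diagonal Agg fblk Pp" using perp by (simp add: is_perp_basis_def)
  have sP: "column j P $ i = 0" if "i \<notin> blk j" for i j
    using P that by (simp add: block_diagonal_def column_def)
  have sPp: "column k Pp $ i = 0" if "i \<notin> fblk k" for i k
    using Pp that by (simp add: block_diagonal_def column_def)
  have disj: "i \<notin> S \<or> i \<notin> T" if "S \<in> Agg" "T \<in> Agg" "S \<noteq> T" for i S T
    using part that by (auto simp: partition_on_def disjoint_def)
  have Agg: "blk j \<in> Agg" "fblk k \<in> Agg" for j k
    using P Pp by (auto simp: block_diagonal_def)
  have "column k Pp \<bullet> (D *v column j P) = 0" for k j
  proof (cases "fblk k = blk j")
    case True
    have "column k Pp \<in> local_orth_complement D blk P (blk j)"
      using perp Agg True unfolding is_perp_basis_def by (metis (mono_tags, lifting) mem_Collect_eq span_base)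
    then have "column k Pp \<bullet> (sub_block D (blk j) (blk j) *v column j P) = 0"
      unfolding column_eq_diag_block[OF P, of j] local_orth_complement_def by blast
    then show ?thesis using sP sPp True by (simp add: inner_sub_block)
  next
    case False
    then show ?thesis using disj[OF Agg(2) Agg(1)] sP sPp by (intro inner_diagonal_disjoint[OF D]) blast
  qed
  then show "transpose Pp ** D ** P = 0"
    by (simp add: vec_eq_iff transpose_mult_component)
  have "column k Pp \<bullet> (D *v column l Pp) = (if k = l then 1 else 0)" for k l
  proof (cases "fblk k = fblk l")
    case True
    have "column k Pp \<bullet> (sub_block D (fblk l) (fblk l) *v column l Pp) = (if k = l then 1 else 0)"
      using perp Agg True unfolding is_perp_basis_def by blast
    then show ?thesis using sPp True by (simp add: inner_sub_block)
  next
    case False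
    then have "column k Pp \<bullet> (D *v column l Pp) = 0"
      using disj[OF Agg(2) Agg(2)] sPp by (intro inner_diagonal_disjoint[OF D]) blast
    then show ?thesis using False by auto
  qed
  then show "transpose Pp ** D ** Pp = mat 1"
    by (simp add: vec_eq_iff transpose_mult_component mat_def)
qed

section \<open>The two-level splitting\<close>

text \<open>
  The global form of the aggregate-wise construction: the relations \<open>Pp\<^sup>T D P = 0\<close> and
  \<open>Pp\<^sup>T D Pp = I\<close> together with the dimension count make \<open>P\<close> and \<open>Pp\<close> span complementary spaces.
\<close>

locale orthogonal_splitting =
  fixes A D :: "real^'n^'n" and P :: "real^'c^'n" and Pp :: "real^'f^'n"
  assumes A: "spd A" and D: "spd D" and A_le_D: "v \<bullet> (A *v v) \<le> v \<bullet> (D *v v)"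
    and full_rank: "rank P = CARD('c)" and card: "CARD('c) + CARD('f) = CARD('n)"
    and orth: "transpose Pp ** D ** P = 0" and orthonormal: "transpose Pp ** D ** Pp = mat 1"
begin

abbreviation "M \<equiv> fine_matrix A Pp"

lemma energy_norm_A_le_D: "energy_norm A v \<le> energy_norm D v"
  using A_le_D by (simp add: energy_norm_def)

lemma P_inj: "P *v x = 0 \<Longrightarrow> x = 0"
  using full_rank full_rank_injective[of P] by (metis injD matrix_vector_mult_0_right)

lemma Pp_adj: "transpose Pp *v (D *v (Pp *v y)) = y" "transpose Pp *v (D *v (P *v x)) = 0"
  using orth orthonormal by (simp_all add: matrix_vector_mul_assoc matrix_mul_assoc)

lemma Pp_inj: "Pp *v y = 0 \<Longrightarrow> y = 0"
  using Pp_adj(1)[of y] by simp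

lemma D_orthogonal: "(Pp *v y) \<bullet> (D *v (P *v x)) = 0"
  using Pp_adj(2)[of x] inner_matrix_vector_transpose[of y "transpose Pp" "D *v (P *v x)"]
  by simp

lemma energy_norm_D_fine: "energy_norm D (Pp *v y) = norm y"
  by (simp add: energy_norm_def inner_congruence orthonormal norm_eq_sqrt_inner)

lemma energy_norm_A_fine: "energy_norm A (Pp *v y) = sqrt (y \<bullet> (M *v y))"
  by (simp add: energy_norm_def inner_congruence fine_matrix_def)

text \<open>
  The two ranges meet only in \<open>0\<close>, since \<open>Pp\<^sup>T D\<close> is a left inverse of \<open>Pp\<close> that annihilates the
  coarse range; their dimensions add up to that of the whole space.
\<close>

lemma decompose: obtains x y where "v = P *v x + Pp *v y"
proof -
  let ?S = "range ((*v) P)" and ?T = "range ((*v) Pp)"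
  have sub: "subspace ?S" "subspace ?T"
    by (simp_all add: linear_subspace_image)
  have "?S \<inter> ?T \<subseteq> {0}"
    using Pp_adj by (auto) (metis matrix_vector_mult_0_right)
  then have "dim (?S \<inter> ?T) = 0"
    by (simp add: dim_eq_0)
  moreover have "dim ?S = CARD('c)"
    using full_rank by (simp add: rank_dim_range)
  moreover have "inj ((*v) Pp)"
    using Pp_adj(1) by (metis injI)
  then have "dim ?T = CARD('f)"
    using full_rank_injective[of Pp] by (simp add: rank_dim_range)
  moreover define W where "W = {a + b |a b. a \<in> ?S \<and> b \<in> ?T}"
  ultimately have "dim W = CARD('n)"
    using dim_sums_Int[OF sub] card unfolding W_def by linarith
  then have "span W = UNIV"
    by (simp flip: dim_eq_full)
  moreover have "span W = W"
    using subspace_sums[OF sub] unfolding W_def by (rule span_eq_iff[THEN iffD2])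
  ultimately have "v \<in> W" by simp
  then show thesis using that unfolding W_def by blast
qed

lemma spd_fine: "spd M"
  unfolding fine_matrix_def by (rule spd_congruence[OF A Pp_inj])

lemma pi_D_coarse: "pi_D D P *v (P *v x) = P *v x"
proof -
  have "matrix_inv (transpose P ** D ** P) ** (transpose P ** D ** P) = mat 1"
    by (rule spd_matrix_inv(1)[OF spd_congruence[OF D P_inj]])
  then have "matrix_inv (transpose P ** D ** P) *v ((transpose P ** D ** P) *v x) = x"
    by (simp only: matrix_vector_mul_assoc matrix_vector_mul_lid)
  then show ?thesis by (simp add: pi_D_def flip: matrix_vector_mul_assoc)
qed

lemma pi_D_fine: "pi_D D P *v (Pp *v y) = 0"
proof -
  have "transpose (0 :: real^'c^'f) = 0" by (simp add: transpose_def vec_eq_iff)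
  then have "transpose (transpose Pp ** D ** P) = 0" by (simp only: orth)
  then have "transpose P ** D ** Pp = 0"
    using D by (simp add: spd_def matrix_transpose_mul matrix_mul_assoc)
  then have "transpose P *v (D *v (Pp *v y)) = 0"
    by (simp add: matrix_vector_mul_assoc matrix_mul_assoc)
  then show ?thesis by (simp add: pi_D_def flip: matrix_vector_mul_assoc)
qed

lemma pi_D_range: obtains x where "pi_D D P *v v = P *v x"
  unfolding pi_D_def by (simp flip: matrix_vector_mul_assoc)

lemma complement_pi_D: obtains y where "v - pi_D D P *v v = Pp *v y"
proof -
  obtain x y where "v = P *v x + Pp *v y" by (rule decompose)
  then have "v - pi_D D P *v v = Pp *v y"
    by (simp add: matrix_vector_right_distrib pi_D_coarse pi_D_fine)
  then show thesis by (rule that)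
qed

lemma pi_f_eq: "pi_f A Pp *v v = Pp *v (matrix_inv M *v (transpose Pp *v (A *v v)))"
  by (simp add: pi_f_def flip: matrix_vector_mul_assoc)

lemma pi_f_fine: "pi_f A Pp *v (Pp *v y) = Pp *v y"
proof -
  have "matrix_inv M *v (M *v y) = y"
    by (simp only: matrix_vector_mul_assoc matrix_vector_mul_lid spd_matrix_inv(1)[OF spd_fine])
  then show ?thesis by (simp add: pi_f_eq fine_matrix_def flip: matrix_vector_mul_assoc)
qed

lemma pi_f_orthogonal: "(Pp *v y) \<bullet> (A *v (v - pi_f A Pp *v v)) = 0"
proof -
  have "M *v (matrix_inv M *v x) = x" for x
    by (simp only: matrix_vector_mul_assoc matrix_vector_mul_lid spd_matrix_inv(2)[OF spd_fine])
  then have "transpose Pp *v (A *v (v - pi_f A Pp *v v)) = 0"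
    by (simp add: pi_f_eq fine_matrix_def matrix_vector_mult_diff_distrib flip: matrix_vector_mul_assoc)
  then show ?thesis
    using inner_matrix_vector_transpose[of y "transpose Pp" "A *v (v - pi_f A Pp *v v)"] by simp
qed

lemma pi_f_Galerkin: "(pi_f A Pp *v w) \<bullet> (A *v (v - pi_f A Pp *v v)) = 0"
  unfolding pi_f_eq[of w] by (rule pi_f_orthogonal)

lemma complement_pi_f_le: "energy_norm A (v - pi_f A Pp *v v) \<le> energy_norm A v"
proof -
  have "(v - pi_f A Pp *v v) \<bullet> (A *v (pi_f A Pp *v v)) = 0"
    using pi_f_Galerkin[of v v] by (simp add: spd_inner_commute[OF A])
  from energy_norm_le_orthogonal_add[OF A this] show ?thesis by simp
qed

text \<open>
  Since \<open>I - pi_D\<close> maps into the fine range, where \<open>\<pi>\<close> is the identity, and \<open>pi_D\<close> vanishes on the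
  fine range, \<open>\<pi> pi_D = \<pi> - (I - pi_D) = -(I - pi_D)(I - \<pi>)\<close>.  On the right-hand side the outer
  factor is controlled by the weak approximation property and the inner one is a contraction in
  the \<open>A\<close>-norm.
\<close>

lemma pi_f_pi_D_swap:
  fixes v :: "real^'n"
  defines "w \<equiv> v - pi_f A Pp *v v"
  shows "pi_f A Pp *v (pi_D D P *v v) = - (w - pi_D D P *v w)"
proof -
  obtain y where y: "v - pi_D D P *v v = Pp *v y" by (rule complement_pi_D)
  have "pi_D D P *v w = pi_D D P *v v"
    by (simp add: w_def matrix_vector_mult_diff_distrib pi_f_eq pi_D_fine)
  moreover have "pi_f A Pp *v (v - pi_D D P *v v) = v - pi_D D P *v v"
    unfolding y by (rule pi_f_fine)
  ultimately show ?thesis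
    by (simp add: w_def matrix_vector_mult_diff_distrib algebra_simps)
qed

lemma ideal_coarse_residual: "u - (mat 1 - pi_f A Pp) *v (pi_D D P *v u) = pi_f A Pp *v u"
proof -
  obtain y where y: "u - pi_D D P *v u = Pp *v y" by (rule complement_pi_D)
  have "pi_f A Pp *v (u - pi_D D P *v u) = u - pi_D D P *v u"
    unfolding y by (rule pi_f_fine)
  then show ?thesis
    by (simp add: matrix_vector_mult_diff_distrib matrix_vector_mult_diff_rdistrib algebra_simps)
qed

text \<open>
  The vector \<open>\<pi>u\<close> is a residual \<open>u - Qx\<close>, and like the Galerkin residual it is \<open>A\<close>-orthogonal to
  the range of \<open>Q = (I - \<pi>)P\<close>.  So their difference lies in that range and is orthogonal to it.
\<close>

lemma ideal_error_eq:
  assumes "(transpose Q ** A ** Q) *v uc = transpose Q *v (A *v u)"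
    and Q: "Q = (mat 1 - pi_f A Pp) ** P"
  shows "u - Q *v uc = pi_f A Pp *v u"
proof -
  obtain x where x: "pi_D D P *v u = P *v x" by (rule pi_D_range)
  have residual: "u - Q *v x = pi_f A Pp *v u"
    using ideal_coarse_residual[of u] by (simp add: Q x flip: matrix_vector_mul_assoc)
  define z where "z = Q *v (uc - x)"
  have "z \<bullet> (A *v (u - Q *v uc)) = 0"
    unfolding z_def by (rule galerkin_best_approximation(1)[OF A assms(1)])
  moreover have "z \<bullet> (A *v (u - Q *v x)) = 0"
  proof -
    have "z = P *v (uc - x) - pi_f A Pp *v (P *v (uc - x))"
      by (simp add: z_def Q matrix_vector_mult_diff_rdistrib flip: matrix_vector_mul_assoc)
    then have "(pi_f A Pp *v u) \<bullet> (A *v z) = 0"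
      using pi_f_Galerkin by simp
    then show ?thesis by (simp add: residual spd_inner_commute[OF A])
  qed
  ultimately have "z \<bullet> (A *v z) = 0"
    by (simp add: z_def matrix_vector_mult_diff_distrib inner_diff_right)
  then have "z = 0" using spd_inner_eq_0_iff[OF A] by blast
  then show ?thesis using residual by (simp add: z_def matrix_vector_mult_diff_distrib)
qed

text \<open>
  With \<open>\<pi>w = Pp h\<close>, the approximation replaces \<open>h\<close> by \<open>q(M)Mh = h - p(M)h\<close>, so the error is
  \<open>- Pp p(M)h\<close>.  Its \<open>A\<close>-norm carries exactly the factor \<open>M\<close> that the smoothing bound requires.
\<close>

lemma approx_pi_f_error:
  "energy_norm A ((approx_pi_f \<nu> A Pp - pi_f A Pp) *v w)
     \<le> energy_norm D (pi_f A Pp *v w) / (2 * real \<nu> + 1)"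
proof -
  define h where "h = matrix_inv M *v (transpose Pp *v (A *v w))"
  define y where "y = mat_poly (sa_poly \<nu>) M *v h"
  have g: "transpose Pp *v (A *v w) = M *v h"
    by (simp only: h_def matrix_vector_mul_assoc[of M] matrix_vector_mul_lid spd_matrix_inv(2)[OF spd_fine])
  have pi_f_w: "pi_f A Pp *v w = Pp *v h"
    by (simp only: pi_f_eq h_def)
  have "1 = sa_poly \<nu> + [:0, 1:] * sa_q \<nu>"
    using sa_q[of \<nu>] by simp
  then have "mat_poly 1 M = mat_poly (sa_poly \<nu> + [:0, 1:] * sa_q \<nu>) M"
    by simp
  then have "mat 1 = mat_poly (sa_poly \<nu>) M + mat_poly (sa_q \<nu>) M ** M"
    by (simp only: mat_poly_1 mat_poly_add mat_poly_mult mat_poly_X mat_poly_commute)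
  then have "h = y + mat_poly (sa_q \<nu>) M *v (M *v h)"
    by (metis matrix_vector_mul_assoc matrix_vector_mul_lid matrix_vector_mult_add_rdistrib y_def)
  then have hy: "mat_poly (sa_q \<nu>) M *v (M *v h) = h - y"
    by (metis add_diff_cancel_left')
  have "(approx_pi_f \<nu> A Pp - pi_f A Pp) *v w = Pp *v (h - y) - Pp *v h"
    by (simp add: matrix_vector_mult_diff_rdistrib approx_pi_f_def pi_f_w g hy
        flip: matrix_vector_mul_assoc)
  also have "\<dots> = Pp *v (- y)"
    by (simp add: matrix_vector_mult_diff_distrib[symmetric])
  finally have "energy_norm A ((approx_pi_f \<nu> A Pp - pi_f A Pp) *v w) = sqrt (y \<bullet> (M *v y))"
    using energy_norm_A_fine[of "- y"] matrix_vector_mult_diff_distrib[of M 0 y] by simp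
  also have "\<dots> \<le> norm h / (2 * real \<nu> + 1)"
  proof -
    have "v \<bullet> (M *v v) \<le> v \<bullet> v" for v
      using A_le_D[of "Pp *v v"] by (simp add: inner_congruence orthonormal fine_matrix_def)
    then have "(2 * real \<nu> + 1)\<^sup>2 * (y \<bullet> (M *v y)) \<le> h \<bullet> h"
      using spd_fine unfolding y_def spd_def by (intro sa_poly_smoothing) auto
    then have "sqrt ((2 * real \<nu> + 1)\<^sup>2 * (y \<bullet> (M *v y))) \<le> norm h"
      by (simp add: norm_eq_sqrt_inner)
    then show ?thesis by (simp add: real_sqrt_mult field_simps)
  qed
  also have "norm h = energy_norm D (pi_f A Pp *v w)"
    by (simp add: pi_f_w energy_norm_D_fine)
  finally show ?thesis .
qed

end

locale weak_splitting = orthogonal_splitting +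
  fixes \<eta> :: real
  assumes eta: "0 < \<eta>" and weak: "weak_approximation A D P \<eta>"
begin

text \<open>
  The property provides some coarse approximation; the \<open>D\<close>-orthogonal projection is at least as
  good in the \<open>D\<close>-norm.
\<close>

lemma complement_pi_D_le: "energy_norm D (v - pi_D D P *v v) \<le> \<eta> * energy_norm A v"
proof -
  obtain vc where vc: "energy_norm D (v - P *v vc) \<le> \<eta> * energy_norm A v"
    using weak unfolding weak_approximation_def by blast
  obtain x where x: "pi_D D P *v v = P *v x" by (rule pi_D_range)
  obtain y where y: "v - pi_D D P *v v = Pp *v y" by (rule complement_pi_D)
  have "energy_norm D (v - pi_D D P *v v)
      \<le> energy_norm D ((v - pi_D D P *v v) + P *v (x - vc))"
    unfolding y by (rule energy_norm_le_orthogonal_add[OF D D_orthogonal])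
  also have "(v - pi_D D P *v v) + P *v (x - vc) = v - P *v vc"
    by (simp add: x matrix_vector_mult_diff_distrib)
  finally show ?thesis using vc by simp
qed

lemma fine_norm_le: "energy_norm D (Pp *v y) \<le> \<eta> * energy_norm A (Pp *v y)"
  using complement_pi_D_le[of "Pp *v y"] by (simp add: pi_D_fine)

text \<open>
  One factor \<open>\<eta>\<close> pays for passing from the \<open>D\<close>-norm to the \<open>A\<close>-norm on the fine range, the other
  for \<open>I - pi_D\<close> in the factorization above.
\<close>

lemma pi_f_pi_D_le:
  "energy_norm D (pi_f A Pp *v (pi_D D P *v v)) \<le> \<eta>\<^sup>2 * energy_norm A v"
proof -
  define w where "w = v - pi_f A Pp *v v"
  have swap: "pi_f A Pp *v (pi_D D P *v v) = 0 - (w - pi_D D P *v w)"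
    using pi_f_pi_D_swap[of v] by (simp add: w_def)
  have "energy_norm D (pi_f A Pp *v (pi_D D P *v v))
      \<le> \<eta> * energy_norm A (pi_f A Pp *v (pi_D D P *v v))"
    unfolding pi_f_eq[of "pi_D D P *v v"] by (rule fine_norm_le)
  also have "energy_norm A (pi_f A Pp *v (pi_D D P *v v)) \<le> energy_norm D (w - pi_D D P *v w)"
    unfolding swap energy_norm_minus_commute[of A 0] using energy_norm_A_le_D by simp
  also have "energy_norm D (w - pi_D D P *v w) \<le> \<eta> * energy_norm A v"
    using complement_pi_D_le[of w] complement_pi_f_le[of v] eta
    by (metis w_def mult_left_mono less_imp_le order_trans)
  finally show ?thesis using eta by (simp add: power2_eq_square mult.assoc)
qed

text \<open>
  Galerkin orthogonality gives \<open>\<parallel>\<pi>u\<parallel>\<^sub>A\<^sup>2 = \<pi>u \<bullet> Au\<close>.  The dual pairing bounds this by the \<open>D\<close>-norm of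
  \<open>\<pi>u\<close>, which on the fine range is at most \<open>\<eta>\<close> times its \<open>A\<close>-norm, and one factor \<open>\<parallel>\<pi>u\<parallel>\<^sub>A\<close> cancels.
\<close>

lemma pi_f_le:
  assumes "is_diagonal D"
  shows "energy_norm A (pi_f A Pp *v u) \<le> \<eta> * norm (diag_inv_sqrt D *v (A *v u))"
proof -
  let ?e = "pi_f A Pp *v u"
  let ?a = "energy_norm A ?e" and ?g = "norm (diag_inv_sqrt D *v (A *v u))"
  have "?e \<bullet> (A *v (u - ?e)) = 0"
    by (rule pi_f_Galerkin)
  then have "?a\<^sup>2 = ?e \<bullet> (A *v u)"
    by (simp add: energy_norm_power2[OF A] matrix_vector_mult_diff_distrib inner_diff_right)
  also have "\<dots> \<le> energy_norm D ?e * ?g"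
    by (rule diag_inv_sqrt_Cauchy_Schwarz[OF D assms])
  also have "\<dots> \<le> (\<eta> * ?a) * ?g"
    unfolding pi_f_eq[of u] by (intro mult_right_mono fine_norm_le) simp
  finally have "?a * ?a \<le> ?a * (\<eta> * ?g)"
    by (simp add: power2_eq_square mult_ac)
  then show ?thesis
    using energy_norm_ge_0[OF A, of ?e] eta
    by (cases "?a = 0") (simp_all add: mult_le_cancel_left)
qed

end

section \<open>The two-level error bound\<close>

theorem theorem4p6:
  fixes A D :: "real^'n^'n"
    and P Pt :: "real^'c^'n"
    and Pp :: "real^'f^'n"
    and Agg :: "'n set set"
    and blk :: "'c \<Rightarrow> 'n set"
    and fblk :: "'f \<Rightarrow> 'n set"
    and eta_w :: real
    and \<nu> :: nat
    and f u e :: "real^'n"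
    and uc uct :: "real^'c"
  assumes "spd A"
    and "spd D" and "is_diagonal D"
    and "\<forall>v. v \<bullet> (A *v v) \<le> v \<bullet> (D *v v)"
    and "partition_on UNIV Agg"
    and "CARD('c) < CARD('n)"
    and "CARD('f) = CARD('n) - CARD('c)"
    and "rank P = CARD('c)"
    and "block_diagonal Agg blk P"
    and "is_perp_basis Agg D blk P fblk Pp"
    and "0 < eta_w" and "weak_approximation A D P eta_w"
    and "1 \<le> \<nu>"
    and "Pt = (mat 1 - approx_pi_f \<nu> A Pp) ** P"
    and "A *v u = f"
    and "(transpose Pt ** A ** Pt) *v uct = transpose Pt *v f"
    and "(transpose P ** transpose (mat 1 - pi_f A Pp) ** A ** (mat 1 - pi_f A Pp) ** P) *v uc
           = (transpose P ** transpose (mat 1 - pi_f A Pp)) *v f"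
    and "e = u - ((mat 1 - pi_f A Pp) ** P) *v uc"
  shows "energy_norm A (u - Pt *v uct)
           \<le> energy_norm A e + energy_norm A ((approx_pi_f \<nu> A Pp - pi_f A Pp) *v (pi_D D P *v u))
       \<and> energy_norm A e + energy_norm A ((approx_pi_f \<nu> A Pp - pi_f A Pp) *v (pi_D D P *v u))
           \<le> eta_w * norm (diag_inv_sqrt D *v (A *v u))
              + eta_w\<^sup>2 / (2 * real \<nu> + 1) * energy_norm A u"
proof -
  let ?\<pi> = "pi_f A Pp" and ?\<pi>t = "approx_pi_f \<nu> A Pp" and ?w = "pi_D D P *v u"
  interpret weak_splitting A D P Pp eta_w
    using assms(1-12) perp_basis_orthonormal[OF assms(3,5,9,10)]
    by unfold_locales auto
  have "transpose ((mat 1 - ?\<pi>) ** P) = transpose P ** transpose (mat 1 - ?\<pi>)"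
    by (rule matrix_transpose_mul)
  then have e: "e = ?\<pi> *v u"
    unfolding assms(18) using assms(15,17) by (intro ideal_error_eq) (simp_all add: matrix_mul_assoc)
  obtain x where x: "?w = P *v x" by (rule pi_D_range)
  \<comment> \<open>The competitor \<open>Pt *v x\<close> uses the coarse coefficients of \<open>pi_D D P *v u\<close>.\<close>
  have "u - Pt *v x = u - (mat 1 - ?\<pi>t) *v ?w"
    by (simp add: assms(14) x flip: matrix_vector_mul_assoc)
  also have "\<dots> = (u - (mat 1 - ?\<pi>) *v ?w) + (?\<pi>t - ?\<pi>) *v ?w"
    by (simp add: matrix_vector_mult_diff_rdistrib)
  also have "\<dots> = e + (?\<pi>t - ?\<pi>) *v ?w"
    by (simp add: ideal_coarse_residual e)
  finally have split: "u - Pt *v x = e + (?\<pi>t - ?\<pi>) *v ?w" .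
  have "energy_norm A (u - Pt *v uct) \<le> energy_norm A (u - Pt *v x)"
    using assms(15,16) by (intro galerkin_best_approximation(2)[OF A]) simp
  also have "\<dots> \<le> energy_norm A e + energy_norm A ((?\<pi>t - ?\<pi>) *v ?w)"
    unfolding split by (rule energy_norm_triangle[OF A])
  finally have first: "energy_norm A (u - Pt *v uct)
      \<le> energy_norm A e + energy_norm A ((?\<pi>t - ?\<pi>) *v ?w)" .
  have "energy_norm A ((?\<pi>t - ?\<pi>) *v ?w) \<le> energy_norm D (?\<pi> *v ?w) / (2 * real \<nu> + 1)"
    by (rule approx_pi_f_error)
  also have "\<dots> \<le> eta_w\<^sup>2 / (2 * real \<nu> + 1) * energy_norm A u"
    using pi_f_pi_D_le[of u] by (simp add: divide_right_mono)
  finally show ?thesis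
    using first pi_f_le[OF assms(3), of u] by (simp add: e)
qed

end
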